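(* If a function $s:[1,\infty)\to\mathbb{C}$ with $s\in L_{\rm loc}[1,\infty)$ is summable $(C,1)$ to some $A\in\mathbb{C}$, then $s$ is also summable $(L,1)$ to the same $A$. The converse implication is not true in general: there exists a function $s\in L_{\rm loc}[1,\infty)$ that is summable $(L,1)$ to some finite number but is not summable $(C,1)$ to any finite number.
   Context: $L_{\rm loc}[1,\infty)$ denotes the set of functions on $[1,\infty)$ that are Lebesgue integrable on every bounded interval $[1,t]$, $t>1$. A function $s\in L_{\rm loc}[1,\infty)$ is called summable $(C,1)$ to $A$ if $\lim_{t\to\infty}\frac1t\int_1^t s(u)\,du=A$. It is called summable $(L,1)$ to $A$ if $\lim_{t\to\infty}\tau(t)=A$, where $\tau(t):=\frac{1}{\log t}\int_1^t\frac{s(u)}{u}\,du$ for $t>1$, with $\log$ the natural logarithm. *)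

theory Defs
  imports "HOL-Analysis.Analysis"
begin

text \<open>
  Functions on \<open>[1, \<infinity>)\<close> are represented by total functions on the reals. Every notion below
  integrates only over \<open>[1, t]\<close>, so values at arguments below 1 never matter.
\<close>

definition L_loc :: "(real \<Rightarrow> complex) set" where
  "L_loc = {s. \<forall>t>1. set_integrable lebesgue {1..t} s}"

text \<open>
  Summability is only meant for members of \<open>L_loc\<close>: the library integral is 0 by convention
  when the integrand is not integrable.
\<close>

definition summable_C1 :: "(real \<Rightarrow> complex) \<Rightarrow> complex \<Rightarrow> bool" where
  "summable_C1 s A \<longleftrightarrow>
     ((\<lambda>t. complex_of_real (1 / t) * (LINT u:{1..t}|lebesgue. s u)) \<longlongrightarrow> A) at_top"

definition log_mean :: "(real \<Rightarrow> complex) \<Rightarrow> real \<Rightarrow> complex" where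
  "log_mean s t = complex_of_real (1 / ln t) * (LINT u:{1..t}|lebesgue. s u / complex_of_real u)"

definition summable_L1 :: "(real \<Rightarrow> complex) \<Rightarrow> complex \<Rightarrow> bool" where
  "summable_L1 s A \<longleftrightarrow> (log_mean s \<longlongrightarrow> A) at_top"

end

theory Submission
  imports Defs "HOL-Real_Asymp.Real_Asymp"
begin

text \<open>
  Write \<open>S t\<close> for the integral of \<open>s\<close> over \<open>[1, t]\<close>. Exchanging the order of integration in
  \<open>1/u = 1/t + \<integral>\<^sub>u\<^sup>t dv/v\<^sup>2\<close> shows that the integral of \<open>s u / u\<close> over \<open>[1, t]\<close> equals
  \<open>S t / t\<close> plus the integral of \<open>(S v / v) / v\<close> over \<open>[1, t]\<close>. If \<open>S v / v\<close> tends to \<open>A\<close>, then after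
  division by \<open>ln t\<close> the first term vanishes and the second, a logarithmic average of \<open>S v / v\<close>,
  tends to \<open>A\<close>. The function \<open>u cos u\<close> refutes the converse, since its logarithmic means are
  \<open>O(1 / ln t)\<close>, while its Cesaro means are \<open>sin t + o(1)\<close>.
\<close>

section \<open>Fubini on a triangle for the completed Lebesgue measure\<close>

text \<open>Closed balls of integer radius around 0 have finite measure and cover the space. This
  makes Fubini available for \<open>lebesgue\<close> itself rather than for its Borel
  restriction.\<close>

lemma sigma_finite_lebesgue: "sigma_finite_measure (lebesgue :: 'a::euclidean_space measure)"
proof
  let ?A = "range (\<lambda>n::nat. cball (0::'a) (real n))"
  have "\<Union> ?A = UNIV"
    using real_arch_simple by (auto simp: dist_norm)
  moreover have "emeasure lebesgue (cball (0::'a) r) \<noteq> \<infinity>" for r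
    using emeasure_bounded_finite[OF bounded_cball, of "0::'a" r] by auto
  ultimately show "\<exists>A. countable A \<and> A \<subseteq> sets (lebesgue :: 'a measure) \<and> \<Union> A = space lebesgue \<and>
      (\<forall>a\<in>A. emeasure lebesgue a \<noteq> \<infinity>)"
    by (intro exI[of _ ?A]) auto
qed

text \<open>Both sides are iterated integrals of \<open>h v *\<^sub>R g u\<close> over the region u
  \<le> v. Fubini applies because a product of integrable functions of separate variables is
  integrable on the product space, and so is its restriction to a measurable region.\<close>

lemma Fubini_triangle:
  fixes g :: "real \<Rightarrow> complex" and h :: "real \<Rightarrow> real"
  assumes g: "integrable lebesgue g" and h: "integrable lebesgue h"
  shows "(LINT v|lebesgue. h v *\<^sub>R (LINT u:{..v}|lebesgue. g u)) =
         (LINT u|lebesgue. (LINT v:{u..}|lebesgue. h v) *\<^sub>R g u)"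
proof -
  interpret L: sigma_finite_measure "lebesgue :: real measure"
    by (rule sigma_finite_lebesgue)
  interpret P: pair_sigma_finite "lebesgue :: real measure" "lebesgue :: real measure" ..
  have [measurable]: "g \<in> borel_measurable lebesgue" "h \<in> borel_measurable lebesgue"
    using g h by auto
  \<comment> \<open>Borel measurability of the two coordinates over the product of Lebesgue
    sigma-algebras is what makes the region u \<le> v measurable there.\<close>
  have id: "(\<lambda>x::real. x) \<in> lebesgue \<rightarrow>\<^sub>M borel"
    by (simp add: borel_measurable_if_I measurable_completion)
  have [measurable]: "fst \<in> borel_measurable (lebesgue \<Otimes>\<^sub>M (lebesgue :: real measure) :: (real \<times> real) measure)"
    "snd \<in> borel_measurable (lebesgue \<Otimes>\<^sub>M (lebesgue :: real measure) :: (real \<times> real) measure)"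
    using measurable_compose[OF measurable_fst id] measurable_compose[OF measurable_snd id]
    by auto
  have "integrable (lebesgue \<Otimes>\<^sub>M lebesgue) (\<lambda>p. h (snd p) *\<^sub>R g (fst p))"
    by (rule P.Fubini_integrable) (use g h in auto)
  moreover have "{p. fst p \<le> snd p} \<in> sets (lebesgue \<Otimes>\<^sub>M lebesgue :: (real \<times> real) measure)"
  proof -
    have "{p \<in> space (lebesgue \<Otimes>\<^sub>M lebesgue :: (real \<times> real) measure). fst p \<le> snd p}
        \<in> sets (lebesgue \<Otimes>\<^sub>M lebesgue :: (real \<times> real) measure)"
      by measurable
    then show ?thesis by (simp add: space_pair_measure)
  qed
  ultimately have "integrable (lebesgue \<Otimes>\<^sub>M lebesgue)
      (\<lambda>p. indicator {p. fst p \<le> snd p} p *\<^sub>R (h (snd p) *\<^sub>R g (fst p)))"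
    by (intro integrable_mult_indicator) auto
  then have "integrable (lebesgue \<Otimes>\<^sub>M lebesgue)
      (\<lambda>(u, v). indicator {p. fst p \<le> snd p} (u, v) *\<^sub>R (h v *\<^sub>R g u))"
    by (simp add: case_prod_beta')
  note F = P.Fubini_integral[OF this]
  have 1: "(LINT u|lebesgue. indicator {p. fst p \<le> snd p} (u, v) *\<^sub>R (h v *\<^sub>R g u)) =
      h v *\<^sub>R (LINT u:{..v}|lebesgue. g u)" for v
    unfolding set_lebesgue_integral_def
    by (subst integral_scaleR_right[symmetric]) (auto intro!: Bochner_Integration.integral_cong simp: indicator_def)
  have 2: "(LINT v|lebesgue. indicator {p. fst p \<le> snd p} (u, v) *\<^sub>R (h v *\<^sub>R g u)) =
      (LINT v:{u..}|lebesgue. h v) *\<^sub>R g u" for u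
  proof -
    \<comment> \<open>Pulling the fixed vector \<open>g u\<close> out of the integral requires the
      scalar factor to be integrable on the half-line.\<close>
    have "set_integrable lebesgue {u..} h"
      unfolding set_integrable_def by (rule integrable_mult_indicator[OF _ h]) auto
    then show ?thesis
      unfolding set_lebesgue_integral_def set_integrable_def
      by (subst integral_scaleR_left[symmetric])
        (auto intro!: Bochner_Integration.integral_cong simp: indicator_def)
  qed
  show ?thesis
    using F unfolding 1 2 .
qed

section \<open>Integration by parts against 1/u\<close>

lemma has_integral_inverse_square:
  fixes u t :: real
  assumes "0 < u" "u \<le> t"
  shows "((\<lambda>v. 1 / v\<^sup>2) has_integral (1 / u - 1 / t)) {u..t}"
proof -
  have "((\<lambda>v. 1 / v\<^sup>2) has_integral (- 1 / t - (- 1 / u))) {u..t}"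
    using assms
    by (intro fundamental_theorem_of_calculus)
      (auto simp flip: has_real_derivative_iff_has_vector_derivative
            intro!: derivative_eq_intros simp: power2_eq_square)
  then show ?thesis by simp
qed

text \<open>On an interval bounded away from 0 the factor 1/u is bounded and measurable, so
  multiplying by it preserves absolute integrability.\<close>

lemma integrable_divide_id:
  fixes s :: "real \<Rightarrow> complex"
  assumes "0 < a" and s: "set_integrable lebesgue {a..t} s"
  shows "set_integrable lebesgue {a..t} (\<lambda>u. s u / of_real u)"
proof -
  have c: "continuous_on {a..t} (\<lambda>u::real. 1 / u)"
    using assms(1) by (intro continuous_intros) auto
  have "set_integrable lebesgue {a..t} (\<lambda>u. (1 / u) *\<^sub>R s u)"
  proof (rule absolutely_integrable_bounded_measurable_product
      [where h = "(*\<^sub>R)" and f = "\<lambda>u. 1 / u", OF _ _ _ _ s])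
    show "bilinear ((*\<^sub>R) :: real \<Rightarrow> complex \<Rightarrow> complex)"
      by (simp add: bilinear_conv_bounded_bilinear bounded_bilinear_scaleR)
    show "(\<lambda>u::real. 1 / u) \<in> borel_measurable (lebesgue_on {a..t})"
      by (rule continuous_imp_measurable_on_sets_lebesgue[OF c]) auto
    show "bounded ((\<lambda>u::real. 1 / u) ` {a..t})"
      by (intro compact_imp_bounded compact_continuous_image c) auto
  qed auto
  then show ?thesis
    by (simp add: scaleR_conv_of_real divide_inverse mult.commute)
qed

text \<open>This is \<open>Fubini_triangle\<close> for \<open>s\<close> and 1/v^2, both cut off to
  [1, t] so that they are integrable on the whole line. The inner integral of 1/v^2 over [u, t] is
  1/u - 1/t, and the term with 1/t becomes the boundary term.\<close>

lemma integral_by_parts_divide_id: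
  fixes s :: "real \<Rightarrow> complex"
  assumes t: "1 \<le> t" and s: "set_integrable lebesgue {1..t} s"
  shows "(LINT u:{1..t}|lebesgue. s u / of_real u) =
    integral {1..t} s / of_real t +
    integral {1..t} (\<lambda>v. (integral {1..v} s / of_real v) / of_real v)"
proof -
  define g where "g = (\<lambda>u. indicator {1..t} u *\<^sub>R s u)"
  define h where "h = (\<lambda>v. indicator {1..t} v *\<^sub>R (1 / v\<^sup>2) :: real)"
  have cont: "continuous_on {1..t} (\<lambda>v::real. 1 / v\<^sup>2)"
    by (intro continuous_intros) auto
  have g: "integrable lebesgue g"
    using s unfolding g_def set_integrable_def .
  have h: "integrable lebesgue h"
    using absolutely_integrable_continuous_real[OF cont] unfolding h_def set_integrable_def .
  have sub: "set_integrable lebesgue {1..v} s" if "v \<le> t" for v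
    using that by (intro absolutely_integrable_on_subinterval[OF s]) auto
  have s_int: "s integrable_on {1..t}"
    using s by (rule set_lebesgue_integral_eq_integral)
  have L: "h v *\<^sub>R (LINT u:{..v}|lebesgue. g u) =
      indicator {1..t} v *\<^sub>R ((integral {1..v} s / of_real v) / of_real v)" for v
  proof (cases "v \<in> {1..t}")
    case True
    have "(LINT u:{..v}|lebesgue. g u) = (LINT u:{1..v}|lebesgue. s u)"
      unfolding set_lebesgue_integral_def g_def using True
      by (intro Bochner_Integration.integral_cong) (auto simp: indicator_def)
    also have "\<dots> = integral {1..v} s"
      using True by (intro set_lebesgue_integral_eq_integral sub) auto
    finally show ?thesis
      using True by (simp add: h_def scaleR_conv_of_real power2_eq_square)
  qed (simp add: h_def)
  have R: "(LINT v:{u..}|lebesgue. h v) *\<^sub>R g u =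
      indicator {1..t} u *\<^sub>R (s u / of_real u - s u / of_real t)" for u
  proof (cases "u \<in> {1..t}")
    case True
    have "(LINT v:{u..}|lebesgue. h v) = (LINT v:{u..t}|lebesgue. 1 / v\<^sup>2)"
      unfolding set_lebesgue_integral_def h_def using True
      by (intro Bochner_Integration.integral_cong) (auto simp: indicator_def)
    also have "\<dots> = integral {u..t} (\<lambda>v. 1 / v\<^sup>2)"
      using True
      by (intro set_lebesgue_integral_eq_integral absolutely_integrable_continuous_real
          continuous_on_subset[OF cont]) auto
    also have "\<dots> = 1 / u - 1 / t"
      using True by (intro integral_unique has_integral_inverse_square) auto
    finally have h_eq: "(LINT v:{u..}|lebesgue. h v) = 1 / u - 1 / t" .
    show ?thesis
      unfolding h_eq using True by (simp add: g_def scaleR_conv_of_real algebra_simps)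
  qed (simp add: g_def)
  \<comment> \<open>A primitive of \<open>s\<close> is continuous, so this integrand is continuous
    and its gauge and Lebesgue integrals coincide.\<close>
  have c: "continuous_on {1..t} (\<lambda>v. (integral {1..v} s / of_real v) / of_real v)"
    by (intro continuous_intros indefinite_integral_continuous_1 s_int) auto
  have "integral {1..t} (\<lambda>v. (integral {1..v} s / of_real v) / of_real v) =
      (LINT v:{1..t}|lebesgue. (integral {1..v} s / of_real v) / of_real v)"
    by (intro set_lebesgue_integral_eq_integral(2)[symmetric]
        absolutely_integrable_continuous_real c)
  also have "\<dots> = (LINT u:{1..t}|lebesgue. s u / of_real u - s u / of_real t)"
    using Fubini_triangle[OF g h] unfolding L R by (simp add: set_lebesgue_integral_def)
  also have "\<dots> = (LINT u:{1..t}|lebesgue. s u / of_real u) - (LINT u:{1..t}|lebesgue. s u / of_real t)"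
    using s by (intro set_integral_diff(2) integrable_divide_id set_integrable_divide) auto
  also have "(LINT u:{1..t}|lebesgue. s u / of_real t) = integral {1..t} s / of_real t"
    using set_lebesgue_integral_eq_integral(2)[OF s] by simp
  finally show ?thesis by simp
qed

section \<open>Logarithmic averages and the implication from (C,1) to (L,1)\<close>

text \<open>The weight 1/v has total mass \<open>ln t\<close> on [1, t], so the constant A
  contributes exactly A. The deviation from A is split at a point T: the part before T is a fixed
  number, and beyond T the deviation is at most e/2.\<close>

lemma logarithmic_average_tendsto:
  fixes h :: "real \<Rightarrow> complex"
  assumes cont: "continuous_on {1..} h" and lim: "(h \<longlongrightarrow> A) at_top"
  shows "((\<lambda>t. integral {1..t} (\<lambda>v. h v / of_real v) / of_real (ln t)) \<longlongrightarrow> A) at_top"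
proof (rule tendstoI)
  fix e :: real assume e: "e > 0"
  define d where "d = (\<lambda>v. (h v - A) / of_real v)"
  have "\<forall>\<^sub>F v in at_top. dist (h v) A < e / 2"
    using lim e by (intro tendstoD) auto
  then obtain T0 where T0: "\<And>v. v \<ge> T0 \<Longrightarrow> dist (h v) A < e / 2"
    by (auto simp: eventually_at_top_linorder)
  define T where "T = max 1 T0"
  have T: "T \<ge> 1" "\<And>v. v \<ge> T \<Longrightarrow> norm (h v - A) \<le> e / 2"
    using T0 by (auto simp: T_def dist_norm less_imp_le)
  define K where "K = integral {1..T} d"
  have int_d: "d integrable_on {a..b}" if "a \<ge> 1" for a b
    unfolding d_def using that
    by (intro integrable_continuous_real continuous_intros continuous_on_subset[OF cont]) auto
  have int_inv: "((\<lambda>v. c / v) has_integral c * (ln b - ln a)) {a..b}" if "1 \<le> a" "a \<le> b" for a b c :: real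
  proof -
    have "((\<lambda>v. c / v) has_integral c * ln b - c * ln a) {a..b}"
      using that by (intro fundamental_theorem_of_calculus)
        (auto simp flip: has_real_derivative_iff_has_vector_derivative intro!: derivative_eq_intros)
    then show ?thesis by (simp add: right_diff_distrib)
  qed
  \<comment> \<open>The head \<open>K\<close> does not depend on \<open>t\<close>. The tail has mass
    \<open>ln t - ln T\<close>, which is at most \<open>ln t\<close> because T is at least
    1.\<close>
  have bound: "norm (integral {1..t} d) \<le> norm K + e / 2 * ln t" if "t \<ge> T" for t
  proof -
    have "norm (integral {T..t} d) \<le> integral {T..t} (\<lambda>v. (e / 2) / v)"
    proof (rule integral_norm_bound_integral)
      show "(\<lambda>v. (e / 2) / v) integrable_on {T..t}"
        using int_inv[of T t "e / 2"] T that by blast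
      show "norm (d v) \<le> (e / 2) / v" if "v \<in> {T..t}" for v
      proof -
        have "norm (h v - A) / v \<le> (e / 2) / v"
          using T(1) T(2)[of v] that by (intro divide_right_mono) auto
        then show ?thesis
          using T(1) that by (simp add: d_def norm_divide)
      qed
    qed (use T int_d in auto)
    also have "\<dots> = e / 2 * (ln t - ln T)"
      using int_inv[of T t "e / 2"] T that by blast
    also have "\<dots> \<le> e / 2 * ln t"
      using e T by (intro mult_left_mono) auto
    finally have le: "norm (integral {T..t} d) \<le> e / 2 * ln t" .
    have eq: "integral {1..t} d = K + integral {T..t} d"
      unfolding K_def using T that int_d
      by (intro Henstock_Kurzweil_Integration.integral_combine[symmetric]) auto
    show ?thesis
      unfolding eq using norm_triangle_ineq[of K "integral {T..t} d"] le by linarith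
  qed
  have split: "integral {1..t} (\<lambda>v. h v / of_real v) = integral {1..t} d + A * of_real (ln t)"
    if "t \<ge> 1" for t
  proof -
    have "((\<lambda>v. A * of_real (1 / v)) has_integral A * of_real (1 * (ln t - ln 1))) {1..t}"
      using int_inv[of 1 t 1] that
      by (intro has_integral_mult_right has_integral_of_real) auto
    then have "((\<lambda>v. d v + A * of_real (1 / v)) has_integral integral {1..t} d + A * of_real (ln t)) {1..t}"
      using int_d[of 1 t] by (intro has_integral_add) (auto simp: integrable_integral)
    moreover have "d v + A * of_real (1 / v) = h v / of_real v" for v
      by (simp add: d_def diff_divide_distrib)
    ultimately show ?thesis by (simp add: integral_unique)
  qed
  have "((\<lambda>t. norm K / ln t) \<longlongrightarrow> 0) at_top"
    by real_asymp
  then have "\<forall>\<^sub>F t in at_top. norm K / ln t < e / 2"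
    using e by (intro order_tendstoD) auto
  then show "\<forall>\<^sub>F t in at_top. dist (integral {1..t} (\<lambda>v. h v / of_real v) / of_real (ln t)) A < e"
    using eventually_ge_at_top[of T] eventually_gt_at_top[of 1]
  proof eventually_elim
    case (elim t)
    then have ln: "ln t > 0" by simp
    have "integral {1..t} (\<lambda>v. h v / of_real v) / of_real (ln t) - A = integral {1..t} d / of_real (ln t)"
      using ln elim by (subst split) (auto simp: field_simps)
    then have "dist (integral {1..t} (\<lambda>v. h v / of_real v) / of_real (ln t)) A =
        norm (integral {1..t} d) / ln t"
      using ln by (simp add: dist_norm norm_divide)
    also have "\<dots> \<le> (norm K + e / 2 * ln t) / ln t"
      using bound[of t] elim ln by (intro divide_right_mono) auto
    also have "\<dots> = norm K / ln t + e / 2"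
      using ln by (simp add: field_simps)
    finally show ?case using elim by linarith
  qed
qed

lemma summable_C1_imp_summable_L1:
  assumes s: "s \<in> L_loc" and C1: "summable_C1 s A"
  shows "summable_L1 s A"
proof -
  have int: "set_integrable lebesgue {1..t} s" if "t > 1" for t
    using s that by (simp add: L_loc_def)
  define m where "m = (\<lambda>v. integral {1..v} s / of_real v)"
  have S: "(LINT u:{1..t}|lebesgue. s u) = integral {1..t} s" if "t > 1" for t
    using int[OF that] by (rule set_lebesgue_integral_eq_integral)
  have m_lim: "(m \<longlongrightarrow> A) at_top"
    using C1 unfolding summable_C1_def
  proof (rule Lim_transform_eventually)
    show "\<forall>\<^sub>F t in at_top. complex_of_real (1 / t) * (LINT u:{1..t}|lebesgue. s u) = m t"
      using eventually_gt_at_top[of 1] by eventually_elim (simp add: S m_def)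
  qed
  \<comment> \<open>Continuity of the primitive is known on compact intervals. At each point
    \<open>x\<close> the interval [1, x + 1] serves, since it contains a neighbourhood of
    \<open>x\<close> relative to the ray.\<close>
  have m_cont: "continuous_on {1..} m"
    unfolding continuous_on_eq_continuous_within
  proof
    fix x :: real assume x: "x \<in> {1..}"
    have "continuous_on {1..x + 1} m"
      unfolding m_def using x
      by (intro continuous_intros indefinite_integral_continuous_1
          set_lebesgue_integral_eq_integral int) auto
    then have "continuous (at x within {1..x + 1}) m"
      using x by (auto simp: continuous_on_eq_continuous_within)
    moreover have "at x within {1..x + 1} = at x within {1..}"
      by (rule at_within_nhd[of _ "{..<x + 1}"]) auto
    ultimately show "continuous (at x within {1..}) m"
      by simp
  qed
  \<comment> \<open>The boundary term is a convergent mean times 1 / ln t, hence vanishes; the other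
    term is the logarithmic average of \<open>m\<close>.\<close>
  have "((\<lambda>t. m t * of_real (1 / ln t) +
      integral {1..t} (\<lambda>v. m v / of_real v) / of_real (ln t)) \<longlongrightarrow> A * of_real 0 + A) at_top"
  proof (intro tendsto_add tendsto_mult m_lim tendsto_of_real logarithmic_average_tendsto m_cont)
    show "((\<lambda>t::real. 1 / ln t) \<longlongrightarrow> 0) at_top" by real_asymp
  qed
  then have "(log_mean s \<longlongrightarrow> A * of_real 0 + A) at_top"
  proof (rule Lim_transform_eventually)
    show "\<forall>\<^sub>F t in at_top. m t * of_real (1 / ln t) +
      integral {1..t} (\<lambda>v. m v / of_real v) / of_real (ln t) = log_mean s t"
      using eventually_gt_at_top[of 1]
    proof eventually_elim
      case (elim t)
      then show ?case
        by (simp add: log_mean_def integral_by_parts_divide_id int m_def add_divide_distrib)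
    qed
  qed
  then show ?thesis by (simp add: summable_L1_def)
qed

section \<open>The counterexample u cos u\<close>

text \<open>Evaluates the complex Lebesgue integrals of the counterexample from real
  antiderivatives; continuity of the integrand supplies the absolute integrability that links them
  to the gauge integral.\<close>

lemma set_integral_of_real_FTC:
  fixes F f :: "real \<Rightarrow> real"
  assumes "a \<le> b" and "continuous_on {a..b} f"
    and "\<And>x. x \<in> {a..b} \<Longrightarrow> (F has_real_derivative f x) (at x within {a..b})"
  shows "(LINT u:{a..b}|lebesgue. complex_of_real (f u)) = of_real (F b - F a)"
proof -
  have "((\<lambda>u. complex_of_real (f u)) has_integral of_real (F b - F a)) {a..b}"
    using assms(1,3) by (intro has_integral_of_real fundamental_theorem_of_calculus)
      (auto simp flip: has_real_derivative_iff_has_vector_derivative)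
  moreover have "set_integrable lebesgue {a..b} (\<lambda>u. complex_of_real (f u))"
    by (intro absolutely_integrable_continuous_real continuous_intros assms)
  ultimately show ?thesis
    by (simp add: set_lebesgue_integral_eq_integral(2) integral_unique)
qed

lemma id_cos_in_L_loc: "(\<lambda>u. complex_of_real (u * cos u)) \<in> L_loc"
  by (auto simp: L_loc_def simp del: of_real_mult
      intro!: absolutely_integrable_continuous_real continuous_intros)

lemma summable_L1_id_cos: "summable_L1 (\<lambda>u. complex_of_real (u * cos u)) 0"
proof -
  have "((\<lambda>t::real. (sin t - sin 1) / ln t) \<longlongrightarrow> 0) at_top"
  proof (rule Lim_null_comparison)
    show "((\<lambda>t::real. 2 / ln t) \<longlongrightarrow> 0) at_top" by real_asymp
    show "\<forall>\<^sub>F t in at_top. norm ((sin t - sin 1) / ln t) \<le> 2 / ln (t::real)"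
      using eventually_gt_at_top[of 1]
    proof eventually_elim
      case (elim t)
      have "\<bar>sin t - sin 1\<bar> \<le> 2"
        using abs_sin_le_one[of t] abs_sin_le_one[of 1] by linarith
      then show ?case
        using elim by (simp add: divide_right_mono)
    qed
  qed
  then have "((\<lambda>t. complex_of_real ((sin t - sin 1) / ln t)) \<longlongrightarrow> of_real 0) at_top"
    by (rule tendsto_of_real)
  then have "(log_mean (\<lambda>u. complex_of_real (u * cos u)) \<longlongrightarrow> of_real 0) at_top"
  proof (rule Lim_transform_eventually)
    show "\<forall>\<^sub>F t in at_top. complex_of_real ((sin t - sin 1) / ln t) =
        log_mean (\<lambda>u. complex_of_real (u * cos u)) t"
      using eventually_gt_at_top[of 1]
    proof eventually_elim
      case (elim t)
      \<comment> \<open>Since u \<ge> 1 on the interval, the factor u cancels, and the remaining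
        cosine has a bounded antiderivative.\<close>
      have "(LINT u:{1..t}|lebesgue. complex_of_real (u * cos u) / of_real u) =
          (LINT u:{1..t}|lebesgue. complex_of_real (cos u))"
        by (intro set_lebesgue_integral_cong) auto
      also have "\<dots> = of_real (sin t - sin 1)"
        using elim
        by (intro set_integral_of_real_FTC) (auto intro!: continuous_intros derivative_eq_intros)
      finally show ?case by (simp add: log_mean_def)
    qed
  qed
  then show ?thesis by (simp add: summable_L1_def)
qed

lemma not_summable_C1_id_cos: "\<not> summable_C1 (\<lambda>u. complex_of_real (u * cos u)) B"
proof
  \<comment> \<open>\<open>G\<close> is an antiderivative of u cos u, so the Cesaro mean is
    \<open>(G t - G 1) / t\<close> for t > 1.\<close>
  define G where "G = (\<lambda>t::real. t * sin t + cos t)"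
  assume "summable_C1 (\<lambda>u. complex_of_real (u * cos u)) B"
  then have "((\<lambda>t. complex_of_real ((G t - G 1) / t)) \<longlongrightarrow> B) at_top"
    unfolding summable_C1_def
  proof (rule Lim_transform_eventually)
    show "\<forall>\<^sub>F t in at_top. complex_of_real (1 / t) *
        (LINT u:{1..t}|lebesgue. complex_of_real (u * cos u)) = complex_of_real ((G t - G 1) / t)"
      using eventually_gt_at_top[of 1]
    proof eventually_elim
      case (elim t)
      then have "(LINT u:{1..t}|lebesgue. complex_of_real (u * cos u)) = of_real (G t - G 1)"
        unfolding G_def
        by (intro set_integral_of_real_FTC) (auto intro!: continuous_intros derivative_eq_intros)
      then show ?case by simp
    qed
  qed
  then have lim: "((\<lambda>t. (G t - G 1) / t) \<longlongrightarrow> Re B) at_top"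
    using tendsto_Re by fastforce
  \<comment> \<open>A limit would be shared by all sequences tending to infinity. Along 2 pi n the
    sine is 0 and the means tend to 0; along pi/2 + 2 pi n it is 1 and they tend to 1.\<close>
  have sub: "filterlim (\<lambda>n. c + 2 * pi * real n) at_top sequentially" for c
    by real_asymp
  have per: "sin (c + 2 * pi * real n) = sin c" "cos (c + 2 * pi * real n) = cos c" for c n
    using sin_2npi[of n] cos_2npi[of n] by (simp_all add: sin_add cos_add mult_ac)
  have "(\<lambda>n. (G (0 + 2 * pi * real n) - G 1) / (0 + 2 * pi * real n)) \<longlonglongrightarrow> 0"
    unfolding G_def per by simp real_asymp
  then have "Re B = 0"
    using filterlim_compose[OF lim sub[of 0]] LIMSEQ_unique by blast
  moreover have "(\<lambda>n. (G (pi / 2 + 2 * pi * real n) - G 1) / (pi / 2 + 2 * pi * real n)) \<longlonglongrightarrow> 1"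
    unfolding G_def per by simp real_asymp
  then have "Re B = 1"
    using filterlim_compose[OF lim sub[of "pi / 2"]] LIMSEQ_unique by blast
  ultimately show False by simp
qed

theorem theorem3:
  shows "(\<forall>(s :: real \<Rightarrow> complex) (A :: complex).
            s \<in> L_loc \<longrightarrow> summable_C1 s A \<longrightarrow> summable_L1 s A) \<and>
         (\<exists>s :: real \<Rightarrow> complex.
            s \<in> L_loc \<and> (\<exists>A :: complex. summable_L1 s A) \<and> \<not> (\<exists>B :: complex. summable_C1 s B))"
  using summable_C1_imp_summable_L1 id_cos_in_L_loc summable_L1_id_cos not_summable_C1_id_cos
  by blast

end
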